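(* Let $\alpha$ be an umbra, $n$ a positive integer, and let $r,\ldots,t$ be finitely many positive integers with $r+\cdots+t\le n$. Then $$k_{r,\ldots,t}\simeq\sum_{(\lambda\vdash r,\ldots,\eta\vdash t)}\frac{(\chi\boldsymbol{.}\chi)^{\nu_\lambda}\cdots(\chi'\boldsymbol{.}\chi')^{\nu_\eta}\,d_\lambda\cdots d_\eta}{(n)_{\nu_\lambda+\cdots+\nu_\eta}}\sum_{\pi\in\Pi_{\nu_\lambda+\cdots+\nu_\eta}}(\chi\boldsymbol{.}\chi)^{\boldsymbol{.}\pi}\,(n\boldsymbol{.}\alpha)_{S_\pi},$$ where $\lambda=(1^{r_1},2^{r_2},\ldots)$ runs over all partitions of $r$, ..., $\eta=(1^{t_1},2^{t_2},\ldots)$ runs over all partitions of $t$, and $S_\pi$ is the subdivision of the multiset $P_{\lambda+\cdots+\eta}=\{\alpha^{(r_1+\cdots+t_1)},(\alpha^2)^{(r_2+\cdots+t_2)},\ldots\}$ corresponding to the partition $\pi\in\Pi_{\nu_\lambda+\cdots+\nu_\eta}$.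
   Context: Umbral calculus: $K$ is a field of characteristic zero, $A$ a set of symbols called umbrae, $E:K[A]\to K$ a linear functional with $E[1]=1$ and $E[\alpha^i\beta^j\cdots\gamma^k]=E[\alpha^i]E[\beta^j]\cdots E[\gamma^k]$ for distinct umbrae. The moments of $\alpha$ are $a_j=E[\alpha^j]$. For umbral polynomials, $p\simeq q$ means $E[p]=E[q]$; $p,q$ are uncorrelated if no umbra occurs in both; $p\equiv q$ (similar) means $E[p^j]=E[q^j]$ for all $j\ge0$. The alphabet is saturated: for every sequence $1,a_1,a_2,\dots$ there are infinitely many umbrae with these moments, and auxiliary umbrae are treated as elements of $A$. Partitions of integers: for $\lambda=(1^{r_1},2^{r_2},\ldots)\vdash i$ ($r_j$ parts equal to $j$), $\nu_\lambda=r_1+r_2+\cdots$ and $d_\lambda=\frac{i!}{r_1!r_2!\cdots(1!)^{r_1}(2!)^{r_2}\cdots}$. Also $(x)_m=x(x-1)\cdots(x-m+1)$. $\Pi_k$ is the set of partitions of $[k]=\{1,\dots,k\}$. The singleton umbra $\chi$ has $E[\chi]=1$ and $E[\chi^j]=0$ for $j\ge2$. The dot product $\gamma\boldsymbol{.}\alpha$ is an umbra with $E[(\gamma\boldsymbol{.}\alpha)^i]=\sum_{\lambda\vdash i}E[(\gamma)_{\nu_\lambda}]\,d_\lambda\,a_1^{r_1}a_2^{r_2}\cdots$. In particular $\kappa_i:=E[(\chi\boldsymbol{.}\alpha)^i]=\sum_{\lambda\vdash i}(-1)^{\nu_\lambda-1}(\nu_\lambda-1)!\,d_\lambda a_1^{r_1}a_2^{r_2}\cdots$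 is the $i$th cumulant of $\alpha$, and $E[(\chi\boldsymbol{.}\chi)^k]=(-1)^{k-1}(k-1)!$ for $k\ge1$. The polykay $k_{r,\ldots,t}$ is characterized umbrally by $k_{r,\ldots,t}\simeq(\chi\boldsymbol{.}\alpha)^r\cdots(\chi'\boldsymbol{.}\alpha')^t$ with $\chi,\dots,\chi'$ uncorrelated singleton umbrae and $\alpha\equiv\cdots\equiv\alpha'$ uncorrelated; that is, $E[k_{r,\ldots,t}]=\kappa_r\cdots\kappa_t$. Power sums: fix uncorrelated umbrae $\alpha_1,\dots,\alpha_n$ similar to $\alpha$; $n\boldsymbol{.}\alpha^j$ denotes $\alpha_1^j+\cdots+\alpha_n^j$ (the same $\alpha_1,\dots,\alpha_n$ for all $j$). $(\chi\boldsymbol{.}\chi)^{\boldsymbol{.}\pi}$ denotes a product, over the blocks $B$ of $\pi$, of the $|B|$th powers of uncorrelated umbrae similar to $\chi\boldsymbol{.}\chi$, so $E[(\chi\boldsymbol{.}\chi)^{\boldsymbol{.}\pi}]=\prod_{B\in\pi}(-1)^{|B|-1}(|B|-1)!$. The factors $(\chi\boldsymbol{.}\chi)^{\nu_\lambda},\ldots,(\chi'\boldsymbol{.}\chi')^{\nu_\eta}$, $(\chi\boldsymbol{.}\chi)^{\boldsymbol{.}\pi}$ and $(n\boldsymbol{.}\alpha)_{S_\pi}$ are mutually uncorrelated. Subdivisions: $\mu^{(f)}$ in a multiset means $\mu$ with multiplicity $f$. Given a multiset $M$ of length $k$ (number of elements counted with multiplicity), fix $s:[k]\to M$ hitting each element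 as many times as its multiplicity. For $\pi\in\Pi_k$ the corresponding subdivision $S_\pi$ is the multiset of the submultisets $\{s(j):j\in B\}$, $B\in\pi$, and $(n\boldsymbol{.}\alpha)_{S_\pi}=\prod_{B\in\pi}n\boldsymbol{.}\bigl(\prod_{j\in B}s(j)\bigr)$. For $M=P_{\lambda+\cdots+\eta}$ each $s(j)$ is a power of $\alpha$, so each factor is a power sum $n\boldsymbol{.}\alpha^m$. *)

theory Defs
  imports Complex_Main "HOL-Library.Poly_Mapping" "HOL-Library.Multiset" "HOL-Library.Disjoint_Sets"
begin

section \<open>Umbral polynomials\<close>

text \<open>
  The elements of the type \<open>'a\<close> are the umbrae. A power product of umbrae is a finitely supported
  exponent function, and \<open>K[A]\<close> consists of the finitely supported \<open>'k\<close>-valued functions on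
  power products, with the convolution product of the library.
\<close>

type_synonym ('a, 'k) umbral_poly = "('a \<Rightarrow>\<^sub>0 nat) \<Rightarrow>\<^sub>0 'k"

definition umbra :: "'a \<Rightarrow> ('a, 'k::field_char_0) umbral_poly" where
  "umbra a = Poly_Mapping.single (Poly_Mapping.single a 1) 1"

definition const :: "'k::field_char_0 \<Rightarrow> ('a, 'k) umbral_poly" where
  "const c = Poly_Mapping.single 0 c"

definition umbrae_in :: "('a, 'k::field_char_0) umbral_poly \<Rightarrow> 'a set" where
  "umbrae_in p = (\<Union>m\<in>Poly_Mapping.keys p. Poly_Mapping.keys m)"

definition uncorrelated ::
    "('a, 'k::field_char_0) umbral_poly \<Rightarrow> ('a, 'k) umbral_poly \<Rightarrow> bool" where
  "uncorrelated p q \<longleftrightarrow> umbrae_in p \<inter> umbrae_in q = {}"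

definition uncorrelated_on ::
    "'i set \<Rightarrow> ('i \<Rightarrow> ('a, 'k::field_char_0) umbral_poly) \<Rightarrow> bool" where
  "uncorrelated_on I p \<longleftrightarrow> (\<forall>i\<in>I. \<forall>j\<in>I. i \<noteq> j \<longrightarrow> uncorrelated (p i) (p j))"

definition replace_umbra ::
    "'a \<Rightarrow> 'a \<Rightarrow> ('a, 'k::field_char_0) umbral_poly \<Rightarrow> ('a, 'k) umbral_poly" where
  "replace_umbra \<alpha> \<beta> p =
     (\<Sum>m\<in>Poly_Mapping.keys p. const (Poly_Mapping.lookup p m) *
        (\<Prod>x\<in>Poly_Mapping.keys m. umbra (if x = \<alpha> then \<beta> else x) ^ Poly_Mapping.lookup m x))"


section \<open>The evaluation functional\<close>

locale umbral_calculus =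
  fixes E :: "('a, 'k::field_char_0) umbral_poly \<Rightarrow> 'k"
  assumes linear: "Vector_Spaces.linear (\<lambda>c p. const c * p) (*) E"
    and E_one: "E 1 = 1"
    and E_uncorrelated:
      "\<And>(A :: 'a set) (e :: 'a \<Rightarrow> nat). finite A \<Longrightarrow>
         E (\<Prod>a\<in>A. umbra a ^ e a) = (\<Prod>a\<in>A. E (umbra a ^ e a))"
    and saturated:
      "\<And>a :: nat \<Rightarrow> 'k. a 0 = 1 \<Longrightarrow> infinite {\<alpha>. \<forall>j. E (umbra \<alpha> ^ j) = a j}"

definition umbral_equiv ::
    "(('a, 'k::field_char_0) umbral_poly \<Rightarrow> 'k) \<Rightarrow>
     ('a, 'k) umbral_poly \<Rightarrow> ('a, 'k) umbral_poly \<Rightarrow> bool" where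
  "umbral_equiv E p q \<longleftrightarrow> E p = E q"

definition similar ::
    "(('a, 'k::field_char_0) umbral_poly \<Rightarrow> 'k) \<Rightarrow>
     ('a, 'k) umbral_poly \<Rightarrow> ('a, 'k) umbral_poly \<Rightarrow> bool" where
  "similar E p q \<longleftrightarrow> (\<forall>j. E (p ^ j) = E (q ^ j))"


section \<open>Integer partitions\<close>

text \<open>
  The partition \<open>\<mu> = (1^r\<^sub>1, 2^r\<^sub>2, \<dots>)\<close> is the multiset of its parts: \<open>r\<^sub>j\<close> is \<open>count \<mu> j\<close>, \<open>\<nu>\<^sub>\<mu>\<close> is
  \<open>size \<mu>\<close>, and \<open>\<mu> + \<dots> + \<eta>\<close> is the sum of multisets.
\<close>

definition int_partitions :: "nat \<Rightarrow> nat multiset set" where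
  "int_partitions i = {\<mu>. 0 \<notin># \<mu> \<and> \<Sum>\<^sub># \<mu> = i}"

definition partition_coeff :: "nat multiset \<Rightarrow> 'k::field_char_0" where
  "partition_coeff \<mu> =
     fact (\<Sum>\<^sub># \<mu>) / (\<Prod>j\<in>set_mset \<mu>. fact (count \<mu> j) * fact j ^ count \<mu> j)"

definition falling :: "'r::comm_ring_1 \<Rightarrow> nat \<Rightarrow> 'r" where
  "falling x m = (\<Prod>i<m. x - of_nat i)"


section \<open>Singleton umbra, dot products and polykays\<close>

definition is_singleton_umbra ::
    "(('a, 'k::field_char_0) umbral_poly \<Rightarrow> 'k) \<Rightarrow> 'a \<Rightarrow> bool" where
  "is_singleton_umbra E \<chi> \<longleftrightarrow>
     E (umbra \<chi>) = 1 \<and> (\<forall>j\<ge>2. E (umbra \<chi> ^ j) = 0)"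

text \<open>
  The umbra \<open>\<delta>\<close> represents the dot product of \<open>\<gamma>\<close> and \<open>\<alpha>\<close>. This is a relation because
  the moments do not single out a symbol, and uncorrelated copies of a dot product are needed.
\<close>

definition is_dot_product ::
    "(('a, 'k::field_char_0) umbral_poly \<Rightarrow> 'k) \<Rightarrow> 'a \<Rightarrow> 'a \<Rightarrow> 'a \<Rightarrow> bool" where
  "is_dot_product E \<gamma> \<alpha> \<delta> \<longleftrightarrow>
     (\<forall>i. E (umbra \<delta> ^ i) =
        (\<Sum>\<mu>\<in>int_partitions i. E (falling (umbra \<gamma>) (size \<mu>)) * partition_coeff \<mu> *
           (\<Prod>j\<in>set_mset \<mu>. E (umbra \<alpha> ^ j) ^ count \<mu> j)))"

text \<open>
  A polykay is determined only up to umbral equivalence; \<open>\<delta> i\<close> stands for the factor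
  \<open>\<chi> i . \<alpha>' i\<close>.
\<close>

definition is_polykay ::
    "(('a, 'k::field_char_0) umbral_poly \<Rightarrow> 'k) \<Rightarrow> 'a \<Rightarrow> nat list \<Rightarrow>
     ('a, 'k) umbral_poly \<Rightarrow> bool" where
  "is_polykay E \<alpha> rs k \<longleftrightarrow>
     (\<exists>\<chi> \<alpha>' \<delta> :: nat \<Rightarrow> 'a.
        uncorrelated_on {..<length rs} (\<lambda>i. umbra (\<chi> i) :: ('a, 'k) umbral_poly) \<and>
        uncorrelated_on {..<length rs} (\<lambda>i. umbra (\<alpha>' i) :: ('a, 'k) umbral_poly) \<and>
        uncorrelated_on {..<length rs} (\<lambda>i. umbra (\<delta> i) :: ('a, 'k) umbral_poly) \<and>
        (\<forall>i<length rs. is_singleton_umbra E (\<chi> i) \<and>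
           similar E (umbra (\<alpha>' i)) (umbra \<alpha>) \<and>
           is_dot_product E (\<chi> i) (\<alpha>' i) (\<delta> i)) \<and>
        umbral_equiv E k (\<Prod>i<length rs. umbra (\<delta> i) ^ (rs ! i)))"


section \<open>Subdivisions and power sums\<close>

definition power_multiset ::
    "'a \<Rightarrow> nat multiset \<Rightarrow> ('a, 'k::field_char_0) umbral_poly multiset" where
  "power_multiset \<alpha> \<mu> = {# umbra \<alpha> ^ j. j \<in># \<mu> #}"

text \<open>\<open>s\<close> lists the elements of \<open>M\<close>, each as often as its multiplicity.\<close>

definition enumerates :: "(nat \<Rightarrow> 'b) \<Rightarrow> 'b multiset \<Rightarrow> bool" where
  "enumerates s M \<longleftrightarrow> {# s j. j \<in># mset_set {1..size M} #} = M"

definition subdivision :: "(nat \<Rightarrow> 'b) \<Rightarrow> nat set set \<Rightarrow> 'b multiset multiset" where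
  "subdivision s \<pi> = {# {# s j. j \<in># mset_set B #}. B \<in># mset_set \<pi> #}"

text \<open>\<open>n . p\<close> for a polynomial \<open>p\<close> in \<open>\<alpha>\<close>: the sum of the \<open>n\<close> copies of \<open>p\<close> in which \<open>\<alpha>\<close> is replaced
  by \<open>as 1, \<dots>, as n\<close>; thus \<open>n . \<alpha>^m\<close> is the \<open>m\<close>th power sum of these umbrae.\<close>

definition dot_sum ::
    "nat \<Rightarrow> (nat \<Rightarrow> 'a) \<Rightarrow> 'a \<Rightarrow> ('a, 'k::field_char_0) umbral_poly \<Rightarrow> ('a, 'k) umbral_poly" where
  "dot_sum n as \<alpha> p = (\<Sum>i=1..n. replace_umbra \<alpha> (as i) p)"

definition dot_sum_subdivision ::
    "nat \<Rightarrow> (nat \<Rightarrow> 'a) \<Rightarrow> 'a \<Rightarrow> ('a, 'k::field_char_0) umbral_poly multiset multiset \<Rightarrow>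
     ('a, 'k) umbral_poly" where
  "dot_sum_subdivision n as \<alpha> S = (\<Prod>T\<in>#S. dot_sum n as \<alpha> (\<Prod>\<^sub># T))"

definition partition_power ::
    "('b set \<Rightarrow> 'a) \<Rightarrow> 'b set set \<Rightarrow> ('a, 'k::field_char_0) umbral_poly" where
  "partition_power d \<pi> = (\<Prod>B\<in>\<pi>. umbra (d B) ^ card B)"

end

theory Submission
  imports Defs
begin

text \<open>
  Write \<open>a\<^sub>j\<close> for the moments of \<open>\<alpha>\<close> and \<open>w m = (-1)^(m-1) (m-1)!\<close>. The polykay evaluates to a product
  of cumulants, and the cumulant of order \<open>r\<close> is the sum of \<open>w \<nu>\<^sub>\<mu> d\<^sub>\<mu> \<Prod> a\<^sub>j\<close> over the partitions \<open>\<mu>\<close>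
  of \<open>r\<close>, where \<open>j\<close> runs through the parts of \<open>\<mu>\<close> (\<open>cumulant_formula\<close>). Multiplying out gives one
  term for each family \<open>\<Lambda>\<close> of partitions, and this term agrees with the summand of \<open>\<Lambda>\<close> in the formula.

  Indeed, \<open>E\<close> is multiplicative on uncorrelated polynomials (\<open>E_mult_uncorrelated\<close>), so the umbrae
  similar to \<open>\<chi>.\<chi>\<close> may be replaced by their moments, which are the numbers \<open>w m\<close>
  (\<open>moment_singleton_dot_singleton\<close>). What remains is the inner sum over the set partitions \<open>\<pi>\<close> of
  \<open>{1..m}\<close>, where \<open>m\<close> is the total number of parts. The number \<open>w m\<close> is the Moebius function of the
  lattice of set partitions, and a product of power sums over the blocks of \<open>\<pi>\<close> is the sum over all
  index maps \<open>{1..m} \<rightarrow> {1..n}\<close> that are constant on the blocks. Hence the sum over \<open>\<pi>\<close> leaves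
  the injective index maps (\<open>moebius_inversion_power_sums\<close>). For such a map the umbrae involved are
  distinct, so that \<open>E\<close> yields the product of the \<open>a\<^sub>j\<close> over all parts in \<open>\<Lambda>\<close>. There are \<open>(n)\<^sub>m\<close>
  injective maps, which cancels the denominator; the denominator does not vanish because
  \<open>m \<le> r + \<dots> + t \<le> n\<close>.
\<close>

section \<open>Set partitions of a set with one more element\<close>

lemma partition_on_insert_singleton:
  assumes "partition_on A \<pi>" and "a \<notin> A"
  shows "partition_on (insert a A) (insert {a} \<pi>)"
  using assms by (auto simp: partition_on_def disjoint_def)

lemma partition_on_insert_into_block:
  assumes "partition_on A \<pi>" and "a \<notin> A" and "B \<in> \<pi>"
  shows "partition_on (insert a A) (insert (insert a B) (\<pi> - {B}))"
proof -
  have disj: "disjnt B (\<Union> (\<pi> - {B}))"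
    using assms(1,3) unfolding partition_on_def disjoint_def disjnt_iff by blast
  then have "partition_on (A - B) (\<pi> - {B})" and "B \<subseteq> A"
    using assms partition_on_insert[OF disj, of A] by (auto simp: insert_absorb)
  moreover have "insert a A - insert a B = A - B" using assms by blast
  moreover have "disjnt (insert a B) (\<Union> (\<pi> - {B}))"
    using disj assms by (auto simp: partition_on_def disjnt_iff)
  ultimately show ?thesis by (subst partition_on_insert) auto
qed

lemma partition_on_insert_cases:
  assumes \<rho>: "partition_on (insert a A) \<rho>" and a: "a \<notin> A"
  obtains \<pi> where "partition_on A \<pi>" and "\<rho> = insert {a} \<pi>"
  | \<pi> B where "partition_on A \<pi>" and "B \<in> \<pi>" and "\<rho> = insert (insert a B) (\<pi> - {B})"
proof -
  obtain C where C: "C \<in> \<rho>" "a \<in> C"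
    using \<rho> by (auto simp: partition_on_def)
  have disjC: "disjnt C (\<Union> (\<rho> - {C}))"
    using \<rho> C(1) unfolding partition_on_def disjoint_def disjnt_iff by blast
  have rest: "partition_on (insert a A - C) (\<rho> - {C})"
    using partition_on_insert[OF disjC, of "insert a A"] \<rho> C(1) by (simp add: insert_absorb)
  show ?thesis
  proof (cases "C = {a}")
    case True
    then have "partition_on A (\<rho> - {C})" and "\<rho> = insert {a} (\<rho> - {C})"
      using rest a C by auto
    then show ?thesis using that(1) by blast
  next
    case False
    define B where "B = C - {a}"
    define \<pi> where "\<pi> = insert B (\<rho> - {C})"
    have CB: "C = insert a B" "B \<noteq> {}"
      using C False by (auto simp: B_def)
    have disj: "D \<inter> C = {}" if "D \<in> \<rho> - {C}" for D
      using disjC that by (auto simp: disjnt_iff)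
    have "partition_on A \<pi>"
      unfolding \<pi>_def
    proof (subst partition_on_insert)
      show "disjnt B (\<Union> (\<rho> - {C}))"
        using disj CB unfolding disjnt_iff by blast
      have "insert a A - C = A - B" using a CB by blast
      then have "partition_on (A - B) (\<rho> - {C})" using rest by simp
      moreover have "B \<subseteq> A"
        using \<rho> C(1) unfolding partition_on_def B_def by blast
      ultimately show "partition_on (A - B) (\<rho> - {C}) \<and> B \<subseteq> A \<and> B \<noteq> {}"
        using CB(2) by blast
    qed
    moreover have "B \<notin> \<rho> - {C}" using disj[of B] CB by blast
    then have "\<rho> = insert (insert a B) (\<pi> - {B})"
      using C CB by (auto simp: \<pi>_def)
    moreover have "B \<in> \<pi>" by (simp add: \<pi>_def)
    ultimately show ?thesis by (intro that(2))
  qed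
qed

text \<open>A set partition of a set with a new element \<open>a\<close> arises in exactly one way from a set partition of
  the old set: \<open>a\<close> either forms a block of its own or joins an existing block. This is the step of
  the induction behind Moebius inversion below.\<close>

lemma sum_partition_on_insert:
  fixes g :: "'b set set \<Rightarrow> 'r::comm_monoid_add"
  assumes "finite A" and a: "a \<notin> A"
  shows "(\<Sum>\<pi> | partition_on (insert a A) \<pi>. g \<pi>) =
    (\<Sum>\<pi> | partition_on A \<pi>. g (insert {a} \<pi>) + (\<Sum>B\<in>\<pi>. g (insert (insert a B) (\<pi> - {B}))))"
proof -
  let ?P = "{\<pi>. partition_on A \<pi>}"
  let ?S = "Sigma ?P (\<lambda>\<pi>. \<pi>)"
  let ?j = "\<lambda>(\<pi>, B). insert (insert a B) (\<pi> - {B})"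
  have notin: "a \<notin> B" if "\<pi> \<in> ?P" "B \<in> \<pi>" for \<pi> B
    using that a by (auto simp: partition_on_def)
  have fin: "finite ?P" "finite ?S"
    using assms by (auto simp: finitely_many_partition_on finite_elements)
  have inj1: "inj_on (insert {a}) ?P"
    using notin by (intro inj_onI) (metis insert_ident singletonI)
  \<comment> \<open>The block containing the new element determines which block was enlarged, and hence the
      original partition.\<close>
  have block: "{C \<in> \<rho>. a \<in> C} = {insert a B}"
    and recover: "\<pi> = insert B (\<rho> - {insert a B})"
    if "\<pi> \<in> ?P" "B \<in> \<pi>" "\<rho> = insert (insert a B) (\<pi> - {B})" for \<pi> \<rho> B
    using that notin[OF that(1)] by auto
  have inj2: "inj_on ?j ?S"
  proof (rule inj_onI)
    fix p q assume p: "p \<in> ?S" and q: "q \<in> ?S" and eq: "?j p = ?j q"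
    obtain \<pi> B \<pi>' B' where pq: "p = (\<pi>, B)" "q = (\<pi>', B')" by fastforce
    have \<pi>: "\<pi> \<in> ?P" "B \<in> \<pi>" and \<pi>': "\<pi>' \<in> ?P" "B' \<in> \<pi>'" using p q pq by auto
    define \<rho> where "\<rho> = insert (insert a B) (\<pi> - {B})"
    have \<rho>: "\<rho> = insert (insert a B') (\<pi>' - {B'})" using eq pq by (simp add: \<rho>_def)
    have "insert a B = insert a B'"
      using block[OF \<pi> \<rho>_def] block[OF \<pi>' \<rho>] by (metis singleton_inject)
    then have "B = B'" using notin[OF \<pi>] notin[OF \<pi>'] by (metis insert_ident)
    then show "p = q"
      using recover[OF \<pi> \<rho>_def] recover[OF \<pi>' \<rho>] pq by metis
  qed
  have disj: "insert {a} ` ?P \<inter> ?j ` ?S = {}"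
  proof -
    have clash: False
      if \<pi>: "\<pi> \<in> ?P" and pB: "(\<pi>', B) \<in> ?S" and eq: "insert {a} \<pi> = ?j (\<pi>', B)"
      for \<pi> \<pi>' B
    proof -
      have \<pi>': "\<pi>' \<in> ?P" "B \<in> \<pi>'" using pB by auto
      have eq': "insert {a} \<pi> = insert (insert a B) (\<pi>' - {B})" using eq by simp
      have "{a} \<in> {insert a B}"
        unfolding block[OF \<pi>' eq', symmetric] by simp
      then have "insert a B = {a}" by simp
      moreover have "a \<notin> B" using notin[OF \<pi>'] .
      moreover have "B \<noteq> {}" using \<pi>' by (auto simp: partition_on_def)
      ultimately show False by auto
    qed
    show ?thesis
    proof (rule equals0I)
      fix \<rho> assume "\<rho> \<in> insert {a} ` ?P \<inter> ?j ` ?S"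
      then obtain \<pi> p where \<pi>: "\<pi> \<in> ?P" "\<rho> = insert {a} \<pi>" and p: "p \<in> ?S" "\<rho> = ?j p"
        by (elim IntE imageE)
      obtain \<pi>' B where pB: "p = (\<pi>', B)" by fastforce
      have "insert {a} \<pi> = ?j p" using \<pi>(2) p(2) by (rule subst)
      then show False using clash[OF \<pi>(1)] p(1) unfolding pB by blast
    qed
  qed
  have "{\<pi>. partition_on (insert a A) \<pi>} = insert {a} ` ?P \<union> ?j ` ?S"
  proof (intro equalityI subsetI)
    fix \<rho> assume "\<rho> \<in> {\<pi>. partition_on (insert a A) \<pi>}"
    then have "partition_on (insert a A) \<rho>" by simp
    then show "\<rho> \<in> insert {a} ` ?P \<union> ?j ` ?S"
      using a
    proof (cases rule: partition_on_insert_cases)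
      case (1 \<pi>)
      then show ?thesis by blast
    next
      case (2 \<pi> B)
      then have "\<rho> = ?j (\<pi>, B)" "(\<pi>, B) \<in> ?S" by auto
      then show ?thesis by blast
    qed
  qed (use a in \<open>auto intro: partition_on_insert_singleton partition_on_insert_into_block\<close>)
  then have "(\<Sum>\<pi> | partition_on (insert a A) \<pi>. g \<pi>) = sum g (insert {a} ` ?P) + sum g (?j ` ?S)"
    using fin disj by (simp add: sum.union_disjoint)
  also have "\<dots> = (\<Sum>\<pi>\<in>?P. g (insert {a} \<pi>)) + (\<Sum>p\<in>?S. g (?j p))"
    by (simp add: sum.reindex[OF inj1] sum.reindex[OF inj2])
  also have "(\<Sum>p\<in>?S. g (?j p)) = (\<Sum>\<pi>\<in>?P. \<Sum>B\<in>\<pi>. g (?j (\<pi>, B)))"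
    using assms fin by (subst sum.Sigma) (auto simp: finite_elements intro: sum.cong)
  finally show ?thesis by (simp add: sum.distrib)
qed

section \<open>Moebius inversion for products of power sums\<close>

text \<open>For \<open>m > 0\<close> this is the Moebius function of the lattice of partitions of an \<open>m\<close>-element set,
  between the finest and the coarsest partition. Truncated subtraction makes the value at \<open>0\<close>
  equal to \<open>1\<close>, so that the numbers are all the moments of \<open>\<chi>.\<chi>\<close>, the zeroth one included.\<close>

definition partition_moebius :: "nat \<Rightarrow> 'r::{comm_ring_1, ring_char_0}" where
  "partition_moebius m = (- 1) ^ (m - 1) * fact (m - 1)"

lemma partition_moebius_0 [simp]: "partition_moebius 0 = 1"
  and partition_moebius_1 [simp]: "partition_moebius (Suc 0) = 1"
  by (simp_all add: partition_moebius_def)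

lemma partition_moebius_Suc:
  "m > 0 \<Longrightarrow> partition_moebius (Suc m) = - of_nat m * partition_moebius m"
  by (cases m) (simp_all add: partition_moebius_def algebra_simps)

definition injections :: "'b set \<Rightarrow> 'i set \<Rightarrow> ('b \<Rightarrow> 'i) set" where
  "injections A N = {f \<in> A \<rightarrow>\<^sub>E N. inj_on f A}"

lemma finite_injections: "finite A \<Longrightarrow> finite N \<Longrightarrow> finite (injections A N)"
  by (simp add: injections_def finite_PiE)

lemma card_injections:
  assumes "finite A" and "finite N" and "card A \<le> card N"
  shows "of_nat (card (injections A N)) = falling (of_nat (card N)) (card A)"
  using card_inj_on_subset_funcset[OF assms(1,2) order.refl] assms(3)
  by (simp add: injections_def falling_def lessThan_atLeast0 of_nat_diff)

lemma injections_insert: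
  assumes "a \<notin> A"
  shows "injections (insert a A) N =
    (\<lambda>(f, i). f(a := i)) ` (SIGMA f:injections A N. N - f ` A)"
proof -
  have "injections (insert a A) N =
      (\<lambda>(i, f). f(a := i)) ` {(i, f). i \<in> N \<and> f \<in> A \<rightarrow>\<^sub>E N - {i} \<and> inj_on f A}"
    using extensional_funcset_extend_domain_inj_on_eq[OF assms] by (simp add: injections_def)
  also have "{(i, f). i \<in> N \<and> f \<in> A \<rightarrow>\<^sub>E N - {i} \<and> inj_on f A} =
      prod.swap ` (SIGMA f:injections A N. N - f ` A)"
    by (force simp: injections_def PiE_iff image_iff)
  finally show ?thesis by (simp only: image_image) (simp add: case_prod_unfold)
qed

text \<open>An injection of \<open>A\<close> extends to \<open>a\<close> by any value outside its range. Summing over all values and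
  subtracting those taken on \<open>A\<close> brings in one correction term for each \<open>b \<in> A\<close>, in which \<open>a\<close>
  and \<open>b\<close> have the same image.\<close>

lemma sum_injections_insert:
  fixes y :: "'i \<Rightarrow> 'b \<Rightarrow> 'r::comm_ring_1"
  assumes "finite A" and "finite N" and a: "a \<notin> A"
  shows "(\<Sum>f\<in>injections (insert a A) N. \<Prod>j\<in>insert a A. y (f j) j) =
    (\<Sum>f\<in>injections A N. (\<Prod>j\<in>A. y (f j) j) * ((\<Sum>i\<in>N. y i a) - (\<Sum>b\<in>A. y (f b) a)))"
proof -
  let ?S = "SIGMA f:injections A N. N - f ` A"
  have inj: "inj_on (\<lambda>(f, i). f(a := i)) ?S"
  proof (rule inj_onI, clarify)
    fix f i g l
    assume f: "f \<in> injections A N" and g: "g \<in> injections A N" and eq: "f(a := i) = g(a := l)"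
    have "f a = g a" using f g a by (auto simp: injections_def PiE_iff extensional_def)
    then show "f = g \<and> i = l" using eq by (metis fun_upd_eqD fun_upd_triv fun_upd_upd)
  qed
  have "(\<Sum>f\<in>injections (insert a A) N. \<Prod>j\<in>insert a A. y (f j) j) =
      (\<Sum>(f, i)\<in>?S. \<Prod>j\<in>insert a A. y ((f(a := i)) j) j)"
    by (subst injections_insert[OF a], subst sum.reindex[OF inj]) (simp only: o_def case_prod_unfold)
  also have "\<dots> = (\<Sum>(f, i)\<in>?S. y i a * (\<Prod>j\<in>A. y (f j) j))"
  proof (rule sum.cong[OF refl], clarify)
    fix f i
    have "(\<Prod>j\<in>A. y ((f(a := i)) j) j) = (\<Prod>j\<in>A. y (f j) j)"
      using a by (intro prod.cong) auto
    then show "(\<Prod>j\<in>insert a A. y ((f(a := i)) j) j) = y i a * (\<Prod>j\<in>A. y (f j) j)"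
      using assms by simp
  qed
  also have "\<dots> = (\<Sum>f\<in>injections A N. (\<Prod>j\<in>A. y (f j) j) * (\<Sum>i\<in>N - f ` A. y i a))"
    using assms
    by (subst sum.Sigma[symmetric]) (auto simp: finite_injections sum_distrib_left mult.commute)
  also have "\<dots> = (\<Sum>f\<in>injections A N.
      (\<Prod>j\<in>A. y (f j) j) * ((\<Sum>i\<in>N. y i a) - (\<Sum>b\<in>A. y (f b) a)))"
  proof (rule sum.cong[OF refl])
    fix f assume "f \<in> injections A N"
    then have "f ` A \<subseteq> N" "inj_on f A" by (auto simp: injections_def)
    then have "(\<Sum>i\<in>N - f ` A. y i a) = (\<Sum>i\<in>N. y i a) - (\<Sum>b\<in>A. y (f b) a)"
      using assms by (simp add: sum_diff sum.reindex)
    then show "(\<Prod>j\<in>A. y (f j) j) * (\<Sum>i\<in>N - f ` A. y i a) =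
        (\<Prod>j\<in>A. y (f j) j) * ((\<Sum>i\<in>N. y i a) - (\<Sum>b\<in>A. y (f b) a))" by simp
  qed
  finally show ?thesis .
qed

lemma prod_absorb_factor:
  fixes u :: "'b \<Rightarrow> 'r::comm_monoid_mult"
  assumes "finite B" and "b \<in> B"
  shows "(\<Prod>j\<in>B. if j = b then u j * c else u j) = (\<Prod>j\<in>B. u j) * c"
  using assms by (simp add: prod.remove[of B b] ac_simps)

text \<open>Expanding the product of the power sums over the blocks of \<open>\<pi>\<close> gives the sum over all maps
  \<open>A \<rightarrow> N\<close> that are constant on the blocks of \<open>\<pi>\<close>, so this is Moebius inversion in the partition
  lattice: only the injective maps remain. The lattice can be avoided by induction on \<open>A\<close>, with the
  functions \<open>y\<close> arbitrary. On the right, adding \<open>a\<close> multiplies by the power sum of \<open>a\<close> and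
  subtracts, for each \<open>b \<in> A\<close>, the sum in which \<open>y i b\<close> is replaced by \<open>y i b * y i a\<close>. On the left,
  the partitions in which \<open>a\<close> is a singleton give the former. Putting \<open>a\<close> into a block \<open>B\<close>
  multiplies the weight by \<open>- card B\<close>, which is one correction term for each \<open>b \<in> B\<close>, and these are
  the latter.\<close>

lemma moebius_inversion_power_sums:
  fixes y :: "'i \<Rightarrow> 'b \<Rightarrow> 'r::{comm_ring_1, ring_char_0}"
  assumes "finite A" and N: "finite N"
  shows "(\<Sum>\<pi> | partition_on A \<pi>. \<Prod>B\<in>\<pi>. partition_moebius (card B) * (\<Sum>i\<in>N. \<Prod>j\<in>B. y i j)) =
    (\<Sum>f\<in>injections A N. \<Prod>j\<in>A. y (f j) j)"
  using assms(1)
proof (induction A arbitrary: y rule: finite_induct)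
  case empty
  have "{\<pi> :: 'b set set. partition_on {} \<pi>} = {{}}" by (simp add: partition_on_empty)
  then show ?case by (simp add: injections_def)
next
  case (insert a A)
  define w where "w = (\<lambda>(y :: 'i \<Rightarrow> 'b \<Rightarrow> 'r) B. partition_moebius (card B) * (\<Sum>i\<in>N. \<Prod>j\<in>B. y i j))"
  \<comment> \<open>\<open>merge b\<close> moves the factor belonging to \<open>a\<close> to the index \<open>b\<close>.\<close>
  define merge where "merge = (\<lambda>b i j. if j = b then y i j * y i a else y i j)"
  let ?p = "\<Sum>i\<in>N. y i a"
  \<comment> \<open>The contribution of all partitions of \<open>insert a A\<close> that restrict to \<open>\<pi>\<close>.\<close>
  have step: "(\<Prod>C\<in>insert {a} \<pi>. w y C) + (\<Sum>B\<in>\<pi>. \<Prod>C\<in>insert (insert a B) (\<pi> - {B}). w y C) =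
      ?p * (\<Prod>C\<in>\<pi>. w y C) - (\<Sum>b\<in>A. \<Prod>C\<in>\<pi>. w (merge b) C)" if \<pi>: "partition_on A \<pi>" for \<pi>
  proof -
    have fin\<pi>: "finite \<pi>" using finite_elements[OF insert.hyps(1) \<pi>] .
    have notin: "a \<notin> B" and finB: "finite B" and ne: "B \<noteq> {}" if "B \<in> \<pi>" for B
      using that \<pi> insert.hyps by (auto simp: partition_on_def intro: finite_subset)
    have single: "(\<Prod>C\<in>insert {a} \<pi>. w y C) = ?p * (\<Prod>C\<in>\<pi>. w y C)"
      using fin\<pi> notin by (subst prod.insert) (auto simp: w_def)
    have into: "(\<Prod>C\<in>insert (insert a B) (\<pi> - {B}). w y C) = - (\<Sum>b\<in>B. \<Prod>C\<in>\<pi>. w (merge b) C)"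
      if B: "B \<in> \<pi>" for B
    proof -
      have other: "w (merge b) C = w y C" if b: "b \<in> B" and C: "C \<in> \<pi> - {B}" for b C
      proof -
        have "b \<notin> C" using \<pi> B b C by (auto simp: partition_on_def disjoint_def)
        then have "(\<Prod>j\<in>C. merge b i j) = (\<Prod>j\<in>C. y i j)" for i
          by (intro prod.cong) (auto simp: merge_def)
        then show ?thesis by (simp add: w_def)
      qed
      have grow: "(\<Prod>j\<in>B. merge b i j) = (\<Prod>j\<in>insert a B. y i j)" if b: "b \<in> B" for b i
        using prod_absorb_factor[OF finB[OF B] b, of "y i" "y i a"] finB[OF B] notin[OF B]
        by (simp add: merge_def mult.commute)
      have "(\<Sum>b\<in>B. \<Prod>C\<in>\<pi>. w (merge b) C) = (\<Sum>b\<in>B. w (merge b) B * (\<Prod>C\<in>\<pi> - {B}. w y C))"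
        using fin\<pi> B other by (intro sum.cong refl) (simp add: prod.remove)
      also have "\<dots> = (\<Sum>b\<in>B. partition_moebius (card B) * (\<Sum>i\<in>N. \<Prod>j\<in>insert a B. y i j)
          * (\<Prod>C\<in>\<pi> - {B}. w y C))"
        by (intro sum.cong refl) (simp add: w_def grow del: prod.insert)
      also have "\<dots> = of_nat (card B) * partition_moebius (card B) * (\<Sum>i\<in>N. \<Prod>j\<in>insert a B. y i j)
          * (\<Prod>C\<in>\<pi> - {B}. w y C)"
        by (simp add: mult.assoc)
      also have "of_nat (card B) * partition_moebius (card B) = - partition_moebius (card (insert a B))"
        using finB[OF B] notin[OF B] ne[OF B]
        by (simp add: partition_moebius_Suc card_gt_0_iff)
      finally have "(\<Sum>b\<in>B. \<Prod>C\<in>\<pi>. w (merge b) C) = - (w y (insert a B) * (\<Prod>C\<in>\<pi> - {B}. w y C))"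
        by (simp add: w_def)
      moreover have "insert a B \<notin> \<pi> - {B}" using notin by blast
      ultimately show ?thesis using fin\<pi> by simp
    qed
    have "(\<Sum>B\<in>\<pi>. \<Prod>C\<in>insert (insert a B) (\<pi> - {B}). w y C) =
        - (\<Sum>B\<in>\<pi>. \<Sum>b\<in>B. \<Prod>C\<in>\<pi>. w (merge b) C)"
      using into by (simp add: sum_negf)
    also have "(\<Sum>B\<in>\<pi>. \<Sum>b\<in>B. \<Prod>C\<in>\<pi>. w (merge b) C) = (\<Sum>b\<in>A. \<Prod>C\<in>\<pi>. w (merge b) C)"
      using sum.partition[OF insert.hyps(1) \<pi>, of "\<lambda>b. \<Prod>C\<in>\<pi>. w (merge b) C"] by simp
    finally show ?thesis using single by simp
  qed
  have IH: "(\<Sum>\<pi> | partition_on A \<pi>. \<Prod>C\<in>\<pi>. w z C) = (\<Sum>f\<in>injections A N. \<Prod>j\<in>A. z (f j) j)" for z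
    unfolding w_def by (rule insert.IH)
  have "(\<Sum>\<pi> | partition_on (insert a A) \<pi>. \<Prod>C\<in>\<pi>. w y C) =
      (\<Sum>\<pi> | partition_on A \<pi>. ?p * (\<Prod>C\<in>\<pi>. w y C) - (\<Sum>b\<in>A. \<Prod>C\<in>\<pi>. w (merge b) C))"
    using insert.hyps step by (subst sum_partition_on_insert) auto
  also have "\<dots> = ?p * (\<Sum>\<pi> | partition_on A \<pi>. \<Prod>C\<in>\<pi>. w y C) -
      (\<Sum>b\<in>A. \<Sum>\<pi> | partition_on A \<pi>. \<Prod>C\<in>\<pi>. w (merge b) C)"
    by (simp add: sum_subtractf sum_distrib_left sum.swap[of _ A])
  also have "\<dots> = (\<Sum>f\<in>injections A N. (\<Prod>j\<in>A. y (f j) j) * ?p) -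
      (\<Sum>b\<in>A. \<Sum>f\<in>injections A N. (\<Prod>j\<in>A. y (f j) j) * y (f b) a)"
  proof -
    have "(\<Prod>j\<in>A. merge b (f j) j) = (\<Prod>j\<in>A. y (f j) j) * y (f b) a" if "b \<in> A" for b f
    proof -
      have "(\<Prod>j\<in>A. merge b (f j) j) = (\<Prod>j\<in>A. if j = b then y (f j) j * y (f b) a else y (f j) j)"
        by (intro prod.cong) (auto simp: merge_def)
      also have "\<dots> = (\<Prod>j\<in>A. y (f j) j) * y (f b) a"
        by (rule prod_absorb_factor[OF insert.hyps(1) that])
      finally show ?thesis .
    qed
    then show ?thesis unfolding IH by (simp add: sum_distrib_left mult.commute)
  qed
  also have "\<dots> = (\<Sum>f\<in>injections A N. (\<Prod>j\<in>A. y (f j) j) * (?p - (\<Sum>b\<in>A. y (f b) a)))"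
    by (simp add: algebra_simps sum_subtractf sum_distrib_left sum_distrib_right sum.swap[of _ A])
  also have "\<dots> = (\<Sum>f\<in>injections (insert a A) N. \<Prod>j\<in>insert a A. y (f j) j)"
    by (rule sum_injections_insert[OF insert.hyps(1) N insert.hyps(2), symmetric])
  finally show ?case by (simp add: w_def)
qed

section \<open>Umbral polynomials and the evaluation functional\<close>

lemma const_mult: "const (a * b) = const a * const b"
  and const_1 [simp]: "const 1 = 1"
  and const_uminus: "const (- a) = - const a"
  and const_of_nat: "const (of_nat k) = of_nat k"
  by (simp_all add: const_def mult_single single_uminus)

lemma const_prod: "const (\<Prod>i\<in>I. f i) = (\<Prod>i\<in>I. const (f i))"
  by (induction I rule: infinite_finite_induct) (simp_all add: const_mult)

lemma umbra_power: "umbra a ^ e = Poly_Mapping.single (Poly_Mapping.single a e) 1"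
  by (induction e) (simp_all add: umbra_def mult_single flip: single_add)

lemma prod_umbra_power:
  "(\<Prod>a\<in>A. umbra (f a) ^ e a) = Poly_Mapping.single (\<Sum>a\<in>A. Poly_Mapping.single (f a) (e a)) 1"
  by (induction A rule: infinite_finite_induct) (simp_all add: umbra_power mult_single)

lemma single_eq_prod_umbra:
  "Poly_Mapping.single m (1 :: 'k::field_char_0) =
    (\<Prod>a\<in>Poly_Mapping.keys m. umbra a ^ Poly_Mapping.lookup m a)"
proof -
  have "(\<Sum>a\<in>Poly_Mapping.keys m. Poly_Mapping.single a (Poly_Mapping.lookup m a)) = m"
    by (rule poly_mapping_eqI) (simp add: lookup_sum lookup_single when_def in_keys_iff)
  then show ?thesis by (simp add: prod_umbra_power)
qed

lemma poly_mapping_expansion: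
  fixes p :: "('a, 'k::field_char_0) umbral_poly"
  shows "p = (\<Sum>m\<in>Poly_Mapping.keys p. const (Poly_Mapping.lookup p m) * Poly_Mapping.single m 1)"
  by (rule poly_mapping_eqI)
    (simp add: const_def mult_single lookup_sum lookup_single when_def in_keys_iff)

lemma umbrae_in_umbra [simp]: "umbrae_in (umbra a :: ('a, 'k::field_char_0) umbral_poly) = {a}"
  by (simp add: umbrae_in_def umbra_def)

lemma umbrae_in_1 [simp]: "umbrae_in 1 = {}"
  by (simp add: umbrae_in_def)

lemma umbrae_in_add: "umbrae_in (p + q) \<subseteq> umbrae_in p \<union> umbrae_in q"
  using keys_add[of p q] by (fastforce simp: umbrae_in_def)

lemma umbrae_in_mult: "umbrae_in (p * q) \<subseteq> umbrae_in p \<union> umbrae_in q"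
proof -
  have "Poly_Mapping.keys m \<subseteq> umbrae_in p \<union> umbrae_in q" if m: "m \<in> Poly_Mapping.keys (p * q)" for m
  proof -
    obtain a b where ab: "m = a + b" "a \<in> Poly_Mapping.keys p" "b \<in> Poly_Mapping.keys q"
      using keys_mult[of p q] m by blast
    then show ?thesis using keys_add[of a b] by (auto simp: umbrae_in_def)
  qed
  then show ?thesis unfolding umbrae_in_def[of "p * q"] by blast
qed

lemma umbrae_in_power: "umbrae_in (p ^ e) \<subseteq> umbrae_in p"
  by (induction e) (use umbrae_in_mult in fastforce)+

lemma umbrae_in_sum: "umbrae_in (\<Sum>i\<in>I. p i) \<subseteq> (\<Union>i\<in>I. umbrae_in (p i))"
proof (induction I rule: infinite_finite_induct)
  case (insert i I)
  then show ?case using umbrae_in_add[of "p i" "sum p I"] by auto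
qed (simp_all add: umbrae_in_def)

lemma umbrae_in_prod: "umbrae_in (\<Prod>i\<in>I. p i) \<subseteq> (\<Union>i\<in>I. umbrae_in (p i))"
proof (induction I rule: infinite_finite_induct)
  case (insert i I)
  then show ?case using umbrae_in_mult[of "p i" "prod p I"] by auto
qed simp_all

lemma umbrae_in_prod_umbra_power: "umbrae_in (\<Prod>i\<in>I. umbra (f i) ^ e i) \<subseteq> f ` I"
proof -
  have "umbrae_in (umbra (f i) ^ e i) \<subseteq> {f i}" for i
    using umbrae_in_power[of "umbra (f i)" "e i"] by simp
  then show ?thesis using umbrae_in_prod[of "\<lambda>i. umbra (f i) ^ e i" I] by blast
qed

lemma uncorrelated_on_umbra_iff:
  "uncorrelated_on I (\<lambda>i. umbra (f i) :: ('a, 'k::field_char_0) umbral_poly) \<longleftrightarrow> inj_on f I"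
  by (auto simp: uncorrelated_on_def uncorrelated_def inj_on_def)

lemma (in umbral_calculus) E_diff: "E (p - q) = E p - E q"
  and E_sum: "E (\<Sum>i\<in>I. f i) = (\<Sum>i\<in>I. E (f i))"
  and E_const_mult: "E (const c * p) = c * E p"
proof -
  interpret Vector_Spaces.linear "\<lambda>c p. const c * p" "(*)" E by (rule linear)
  show "E (p - q) = E p - E q"
    and "E (\<Sum>i\<in>I. f i) = (\<Sum>i\<in>I. E (f i))" and "E (const c * p) = c * E p"
    by (rule diff sum scale)+
qed

lemma (in umbral_calculus) E_expansion:
  "E p = (\<Sum>m\<in>Poly_Mapping.keys p. Poly_Mapping.lookup p m * E (Poly_Mapping.single m 1))"
  using arg_cong[OF poly_mapping_expansion[of p], of E] by (simp only: E_sum E_const_mult)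

text \<open>The axiom on \<open>E\<close> speaks of power products only. Bilinearity carries it over to arbitrary
  polynomials, since uncorrelated polynomials consist of power products in disjoint sets of umbrae.\<close>

lemma (in umbral_calculus) E_mult_uncorrelated:
  assumes "uncorrelated p q"
  shows "E (p * q) = E p * E q"
proof -
  have mono: "E (Poly_Mapping.single m 1 * Poly_Mapping.single l 1) =
      E (Poly_Mapping.single m 1) * E (Poly_Mapping.single l 1)"
    if m: "m \<in> Poly_Mapping.keys p" and l: "l \<in> Poly_Mapping.keys q" for m l
  proof -
    define e where "e = (\<lambda>a. if a \<in> Poly_Mapping.keys m then Poly_Mapping.lookup m a
      else Poly_Mapping.lookup l a)"
    have disj: "Poly_Mapping.keys m \<inter> Poly_Mapping.keys l = {}"
      using assms m l by (auto simp: uncorrelated_def umbrae_in_def)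
    have em: "Poly_Mapping.single m 1 = (\<Prod>a\<in>Poly_Mapping.keys m. umbra a ^ e a)"
      by (simp add: single_eq_prod_umbra e_def)
    have el: "Poly_Mapping.single l 1 = (\<Prod>a\<in>Poly_Mapping.keys l. umbra a ^ e a)"
      unfolding single_eq_prod_umbra e_def using disj by (intro prod.cong) auto
    have "E (Poly_Mapping.single m 1 * Poly_Mapping.single l 1) =
        E (\<Prod>a\<in>Poly_Mapping.keys m \<union> Poly_Mapping.keys l. umbra a ^ e a)"
      unfolding em el using disj by (simp add: prod.union_disjoint)
    also have "\<dots> = (\<Prod>a\<in>Poly_Mapping.keys m. E (umbra a ^ e a)) *
        (\<Prod>a\<in>Poly_Mapping.keys l. E (umbra a ^ e a))"
      using disj by (subst E_uncorrelated) (simp_all add: prod.union_disjoint)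
    finally show ?thesis unfolding em el by (simp add: E_uncorrelated)
  qed
  have "p * q = (\<Sum>m\<in>Poly_Mapping.keys p. \<Sum>l\<in>Poly_Mapping.keys q.
      const (Poly_Mapping.lookup p m) * (const (Poly_Mapping.lookup q l) *
      (Poly_Mapping.single m 1 * Poly_Mapping.single l 1)))"
    by (subst poly_mapping_expansion[of p], subst poly_mapping_expansion[of q])
      (simp add: sum_product ac_simps)
  then have "E (p * q) = (\<Sum>m\<in>Poly_Mapping.keys p. \<Sum>l\<in>Poly_Mapping.keys q.
      Poly_Mapping.lookup p m * (Poly_Mapping.lookup q l *
      (E (Poly_Mapping.single m 1) * E (Poly_Mapping.single l 1))))"
    by (simp add: E_sum E_const_mult mono)
  also have "\<dots> = E p * E q"
    by (simp add: E_expansion[of p] E_expansion[of q] sum_product ac_simps)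
  finally show ?thesis .
qed

lemma (in umbral_calculus) E_prod_distinct_umbrae:
  assumes "finite I" and inj: "inj_on f I"
  shows "E (\<Prod>i\<in>I. umbra (f i) ^ e i) = (\<Prod>i\<in>I. E (umbra (f i) ^ e i))"
  using E_uncorrelated[of "f ` I" "e \<circ> the_inv_into I f"] assms
  by (simp add: prod.reindex the_inv_into_f_f)

section \<open>Integer partitions\<close>

lemma finite_int_partitions: "finite (int_partitions i)"
proof (rule finite_subset)
  show "int_partitions i \<subseteq> mset ` {xs. set xs \<subseteq> {..i} \<and> length xs \<le> i}"
  proof
    fix \<mu> assume \<mu>: "\<mu> \<in> int_partitions i"
    obtain xs where xs: "\<mu> = mset xs" using ex_mset by metis
    have sum: "sum_list xs = i" and pos: "0 \<notin> set xs"
      using \<mu> by (auto simp: xs int_partitions_def sum_mset_sum_list)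
    have "length xs \<le> sum_list xs"
      using pos by (induction xs) auto
    moreover have "x \<le> i" if "x \<in> set xs" for x
      using member_le_sum_list[OF that] sum by simp
    ultimately show "\<mu> \<in> mset ` {xs. set xs \<subseteq> {..i} \<and> length xs \<le> i}"
      using sum by (auto simp: xs)
  qed
qed (simp add: finite_lists_length_le)

lemma size_int_partition_le: "\<mu> \<in> int_partitions i \<Longrightarrow> size \<mu> \<le> i"
proof -
  have "0 \<notin># \<mu> \<Longrightarrow> size \<mu> \<le> \<Sum>\<^sub># \<mu>" for \<mu> :: "nat multiset"
    by (induction \<mu>) auto
  then show "\<mu> \<in> int_partitions i \<Longrightarrow> size \<mu> \<le> i"
    by (auto simp: int_partitions_def)
qed

lemma falling_of_nat_nonzero: "m \<le> n \<Longrightarrow> falling (of_nat n :: 'k::field_char_0) m \<noteq> 0"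
proof -
  assume "m \<le> n"
  have "of_nat n - of_nat i \<noteq> (0 :: 'k)" if "i < m" for i
  proof -
    have "n \<noteq> i" using \<open>m \<le> n\<close> that by linarith
    then show ?thesis by (simp only: right_minus_eq of_nat_eq_iff not_False_eq_True)
  qed
  then show "falling (of_nat n :: 'k) m \<noteq> 0"
    unfolding falling_def by (subst prod_zero_iff) auto
qed

lemma prod_list_sum_listset:
  fixes g :: "'b \<Rightarrow> 'r::comm_semiring_1"
  shows "(\<Prod>r\<leftarrow>rs. \<Sum>\<mu>\<in>F r. g \<mu>) = (\<Sum>\<Lambda>\<in>listset (map F rs). \<Prod>\<mu>\<leftarrow>\<Lambda>. g \<mu>)"
proof (induction rs)
  case (Cons r rs)
  let ?L = "listset (map F rs)"
  have "(\<Sum>\<Lambda>\<in>set_Cons (F r) ?L. \<Prod>\<mu>\<leftarrow>\<Lambda>. g \<mu>) =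
      (\<Sum>(\<mu>, \<Lambda>)\<in>F r \<times> ?L. g \<mu> * (\<Prod>\<mu>\<leftarrow>\<Lambda>. g \<mu>))"
  proof -
    have "set_Cons (F r) ?L = (\<lambda>(\<mu>, \<Lambda>). \<mu> # \<Lambda>) ` (F r \<times> ?L)"
      by (auto simp: set_Cons_def)
    moreover have "inj_on (\<lambda>(\<mu>, \<Lambda>). \<mu> # \<Lambda>) (F r \<times> ?L)"
      by (auto simp: inj_on_def)
    ultimately show ?thesis by (simp add: sum.reindex case_prod_unfold)
  qed
  then show ?case
    by (simp add: Cons.IH sum_product sum.cartesian_product)
qed simp

lemma length_listset: "\<Lambda> \<in> listset As \<Longrightarrow> length \<Lambda> = length As"
proof (induction As arbitrary: \<Lambda>)
  case (Cons A As)
  then show ?case by (auto simp: set_Cons_def)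
qed simp

lemma prod_list_map_conv_nth: "(\<Prod>x\<leftarrow>xs. f x) = (\<Prod>i<length xs. f (xs ! i))"
  by (simp add: prod.list_conv_set_nth atLeast0LessThan)

lemma size_sum_list_partitions_le:
  "\<Lambda> \<in> listset (map int_partitions rs) \<Longrightarrow> size (sum_list \<Lambda>) \<le> sum_list rs"
proof (induction rs arbitrary: \<Lambda>)
  case (Cons r rs)
  then show ?case using size_int_partition_le by (fastforce simp: set_Cons_def intro: add_mono)
qed simp

lemma prod_mset_sum_list:
  "(\<Prod>j\<in>#sum_list \<Lambda>. g j) = (\<Prod>\<mu>\<leftarrow>\<Lambda>. \<Prod>j\<in>#\<mu>. g j)"
  by (induction \<Lambda>) simp_all

section \<open>The singleton umbra and cumulants\<close>

lemma falling_0 [simp]: "falling x 0 = 1"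
  by (simp add: falling_def)

lemma falling_Suc: "falling x (Suc m) = falling x m * (x - of_nat m)"
  by (simp add: falling_def)

lemma (in umbral_calculus) E_falling_Suc_mult:
  "E (falling p (Suc m) * q) = E (falling p m * (p * q)) - of_nat m * E (falling p m * q)"
proof -
  have "falling p (Suc m) * q = falling p m * (p * q) - const (of_nat m) * (falling p m * q)"
    by (simp only: falling_Suc const_of_nat) (simp only: algebra_simps)
  then show ?thesis by (simp only: E_diff E_const_mult)
qed

text \<open>Since \<open>E\<close> annihilates all powers of \<open>\<chi>\<close> above the first, and the falling
  factorial has no constant term for \<open>m > 0\<close>, only its coefficient of \<open>\<chi>\<close> matters, which is \<open>(-1)(-2)\<dots>(-(m-1))\<close>.
  The proof follows this coefficient through the recursion of the falling factorial.\<close>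

lemma (in umbral_calculus) E_falling_singleton:
  assumes "is_singleton_umbra E \<chi>"
  shows "E (falling (umbra \<chi>) m) = partition_moebius m"
proof -
  let ?x = "umbra \<chi>"
  have x1: "E ?x = 1" and x2: "E (?x ^ (j + 2)) = 0" for j
    using assms unfolding is_singleton_umbra_def by (blast intro: le_add2)+
  have high: "E (falling ?x m * ?x ^ (j + 2)) = 0" for m j
  proof (induction m arbitrary: j)
    case 0
    then show ?case using x2[of j] by simp
  next
    case (Suc m)
    then show ?case
      using Suc.IH[of "Suc j"] Suc.IH[of j] by (simp add: E_falling_Suc_mult)
  qed
  have first: "E (falling ?x m * ?x) = (if m = 0 then 1 else 0)" for m
  proof (induction m)
    case 0
    then show ?case by (simp add: x1)
  next
    case (Suc m)
    then show ?case
      using high[of m 0] by (simp add: E_falling_Suc_mult power2_eq_square)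
  qed
  show ?thesis
  proof (induction m)
    case 0
    then show ?case by (simp add: E_one)
  next
    case (Suc m)
    have "E (falling ?x (Suc m)) = (if m = 0 then 1 else 0) - of_nat m * partition_moebius m"
      using E_falling_Suc_mult[of ?x m 1] first[of m] Suc.IH by simp
    then show ?case by (cases "m = 0") (simp_all add: partition_moebius_Suc)
  qed
qed

lemma partition_coeff_replicate_1: "partition_coeff (replicate_mset m (Suc 0)) = 1"
  by (cases "m = 0") (simp_all add: partition_coeff_def)

text \<open>Among the partitions of \<open>m\<close> only \<open>1 + \<dots> + 1\<close> contributes to the moment of \<open>\<chi>.\<chi>\<close>, because any part
  greater than \<open>1\<close> yields a vanishing moment of \<open>\<chi>\<close>.\<close>

lemma (in umbral_calculus) moment_singleton_dot_singleton:
  assumes \<chi>: "is_singleton_umbra E \<chi>" and \<gamma>: "is_dot_product E \<chi> \<chi> \<gamma>"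
  shows "E (umbra \<gamma> ^ m) = partition_moebius m"
proof -
  define t where "t = (\<lambda>\<mu>. E (falling (umbra \<chi>) (size \<mu>)) * partition_coeff \<mu> *
      (\<Prod>j\<in>set_mset \<mu>. E (umbra \<chi> ^ j) ^ count \<mu> j))"
  let ?ones = "replicate_mset m (1 :: nat)"
  have zero: "t \<mu> = 0" if \<mu>: "\<mu> \<in> int_partitions m - {?ones}" for \<mu>
  proof -
    have "\<exists>j\<in>#\<mu>. j \<noteq> 1"
    proof (rule ccontr)
      assume "\<not> (\<exists>j\<in>#\<mu>. j \<noteq> 1)"
      then have "\<mu> = replicate_mset (size \<mu>) 1" by (simp add: set_mset_subset_singletonD subsetI)
      then obtain l where l: "\<mu> = replicate_mset l 1" by blast
      then have "l = m" using \<mu> by (auto simp: int_partitions_def)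
      then show False using \<mu> l by simp
    qed
    then obtain j where j: "j \<in># \<mu>" "j \<noteq> 1" by blast
    moreover have "0 \<notin># \<mu>" using \<mu> by (simp add: int_partitions_def)
    then have "j \<noteq> 0" using j(1) by metis
    ultimately have "E (umbra \<chi> ^ j) = 0"
      using \<chi> by (auto simp: is_singleton_umbra_def)
    then have "(\<Prod>j\<in>set_mset \<mu>. E (umbra \<chi> ^ j) ^ count \<mu> j) = 0"
      using j(1) by (intro prod_zero) (auto simp: count_greater_zero_iff intro!: bexI[of _ j])
    then show ?thesis by (simp add: t_def)
  qed
  have "E (umbra \<gamma> ^ m) = (\<Sum>\<mu>\<in>int_partitions m. t \<mu>)"
    using \<gamma> by (simp add: is_dot_product_def t_def)
  also have "\<dots> = (\<Sum>\<mu>\<in>{?ones}. t \<mu>)"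
  proof (rule sum.mono_neutral_right)
    show "{?ones} \<subseteq> int_partitions m"
      by (simp add: int_partitions_def)
  qed (use zero in \<open>simp_all add: finite_int_partitions\<close>)
  also have "\<dots> = partition_moebius m"
    using \<chi> partition_coeff_replicate_1[where 'a = 'k, of m]
    by (cases "m = 0")
      (simp_all add: t_def E_falling_singleton partition_coeff_replicate_1 is_singleton_umbra_def
        del: replicate_mset_Suc)
  finally show ?thesis .
qed

lemma (in umbral_calculus) cumulant_formula:
  assumes "is_singleton_umbra E \<chi>" and "is_dot_product E \<chi> \<beta> \<delta>"
    and "similar E (umbra \<beta>) (umbra \<alpha>)"
  shows "E (umbra \<delta> ^ r) = (\<Sum>\<mu>\<in>int_partitions r.
    partition_moebius (size \<mu>) * partition_coeff \<mu> * (\<Prod>j\<in>#\<mu>. E (umbra \<alpha> ^ j)))"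
proof -
  have moment: "E (umbra \<beta> ^ j) = E (umbra \<alpha> ^ j)" for j
    using assms(3) by (simp add: similar_def)
  have "E (umbra \<delta> ^ r) = (\<Sum>\<mu>\<in>int_partitions r. E (falling (umbra \<chi>) (size \<mu>)) *
      partition_coeff \<mu> * (\<Prod>j\<in>set_mset \<mu>. E (umbra \<beta> ^ j) ^ count \<mu> j))"
    using assms(2) unfolding is_dot_product_def by blast
  then show ?thesis
    by (simp only: moment E_falling_singleton[OF assms(1)] image_prod_mset_multiplicity)
qed

section \<open>Subdivisions and power sums\<close>

lemma replace_umbra_power:
  "replace_umbra \<alpha> \<beta> (umbra \<alpha> ^ e :: ('a, 'k::field_char_0) umbral_poly) = umbra \<beta> ^ e"
  by (simp add: replace_umbra_def umbra_power)

lemma dot_sum_subdivision_powers: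
  assumes s: "\<And>j. j \<in> A \<Longrightarrow> s j = umbra \<alpha> ^ e j" and \<pi>: "partition_on A \<pi>"
  shows "dot_sum_subdivision n as \<alpha> (subdivision s \<pi>) =
    (\<Prod>B\<in>\<pi>. \<Sum>i\<in>{1..n}. \<Prod>j\<in>B. umbra (as i) ^ e j)"
proof -
  have "dot_sum_subdivision n as \<alpha> (subdivision s \<pi>) = (\<Prod>B\<in>\<pi>. dot_sum n as \<alpha> (\<Prod>j\<in>B. s j))"
    by (simp add: dot_sum_subdivision_def subdivision_def prod_unfold_prod_mset
        image_mset.compositionality o_def)
  also have "\<dots> = (\<Prod>B\<in>\<pi>. \<Sum>i\<in>{1..n}. \<Prod>j\<in>B. umbra (as i) ^ e j)"
  proof (rule prod.cong[OF refl])
    fix B assume "B \<in> \<pi>"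
    then have B: "(\<Prod>j\<in>B. s j) = umbra \<alpha> ^ (\<Sum>j\<in>B. e j)"
      using \<pi> s by (auto simp: power_sum partition_on_def intro!: prod.cong)
    show "dot_sum n as \<alpha> (\<Prod>j\<in>B. s j) = (\<Sum>i\<in>{1..n}. \<Prod>j\<in>B. umbra (as i) ^ e j)"
      unfolding B dot_sum_def replace_umbra_power by (simp add: power_sum)
  qed
  finally show ?thesis .
qed

lemma const_partition_moebius:
  "const (partition_moebius m :: 'k::field_char_0) =
    (partition_moebius m :: ('a, 'k) umbral_poly)"
proof -
  have "const ((- 1) ^ l :: 'k) = ((- 1) ^ l :: ('a, 'k) umbral_poly)" for l
    by (induction l) (simp_all add: const_mult const_uminus)
  moreover have "const (fact l :: 'k) = (fact l :: ('a, 'k) umbral_poly)" for l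
  proof -
    have "const (of_nat (fact l) :: 'k) = (of_nat (fact l) :: ('a, 'k) umbral_poly)"
      by (rule const_of_nat)
    then show ?thesis by simp
  qed
  ultimately show ?thesis by (simp add: partition_moebius_def const_mult)
qed

text \<open>After Moebius inversion only injective index maps \<open>f\<close> remain. For these the umbrae \<open>as (f j)\<close> are
  distinct, so every map contributes the same product of moments, and the falling factorial counts
  the injections.\<close>

lemma (in umbral_calculus) E_moebius_power_sums:
  assumes "finite A" and "card A \<le> n" and inj: "inj_on as {1..n}"
    and similar: "\<And>i j. i \<in> {1..n} \<Longrightarrow> E (umbra (as i) ^ j) = E (umbra \<alpha> ^ j)"
  shows "(\<Sum>\<pi> | partition_on A \<pi>. (\<Prod>B\<in>\<pi>. partition_moebius (card B)) *
      E (\<Prod>B\<in>\<pi>. \<Sum>i\<in>{1..n}. \<Prod>j\<in>B. umbra (as i) ^ e j)) =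
    falling (of_nat n) (card A) * (\<Prod>j\<in>A. E (umbra \<alpha> ^ e j))"
proof -
  let ?p = "\<lambda>B. \<Sum>i\<in>{1..n}. \<Prod>j\<in>B. umbra (as i) ^ e j"
  have "(\<Sum>\<pi> | partition_on A \<pi>. (\<Prod>B\<in>\<pi>. partition_moebius (card B)) * E (\<Prod>B\<in>\<pi>. ?p B)) =
      E (\<Sum>\<pi> | partition_on A \<pi>. \<Prod>B\<in>\<pi>. partition_moebius (card B) * ?p B)"
    by (simp add: E_sum prod.distrib const_prod
        flip: E_const_mult const_partition_moebius)
  also have "\<dots> = E (\<Sum>f\<in>injections A {1..n}. \<Prod>j\<in>A. umbra (as (f j)) ^ e j)"
    using assms(1) by (simp only: moebius_inversion_power_sums finite_atLeastAtMost)
  also have "\<dots> = (\<Sum>f\<in>injections A {1..n}. \<Prod>j\<in>A. E (umbra \<alpha> ^ e j))"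
    unfolding E_sum
  proof (rule sum.cong[OF refl])
    fix f assume f: "f \<in> injections A {1..n}"
    then have "inj_on (as \<circ> f) A"
      using inj by (auto simp: injections_def PiE_iff intro!: comp_inj_on inj_on_subset[OF inj])
    then have "E (\<Prod>j\<in>A. umbra (as (f j)) ^ e j) = (\<Prod>j\<in>A. E (umbra (as (f j)) ^ e j))"
      using E_prod_distinct_umbrae[OF assms(1), of "as \<circ> f" e] by simp
    then show "E (\<Prod>j\<in>A. umbra (as (f j)) ^ e j) = (\<Prod>j\<in>A. E (umbra \<alpha> ^ e j))"
      using f similar by (auto simp: injections_def PiE_iff intro!: prod.cong)
  qed
  also have "\<dots> = falling (of_nat n) (card A) * (\<Prod>j\<in>A. E (umbra \<alpha> ^ e j))"
    using assms(1,2) by (simp add: card_injections del: One_nat_def)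
  finally show ?thesis .
qed

text \<open>The power sums need the exponents of the enumerated powers of \<open>\<alpha>\<close>. They are chosen here without
  appeal to the injectivity of \<open>j \<mapsto> \<alpha>\<^sup>j\<close>: applying \<open>E\<close> to the two equal multisets of powers already
  gives the product of moments.\<close>

lemma (in umbral_calculus) enumeration_of_powers:
  fixes s :: "nat \<Rightarrow> ('a, 'k) umbral_poly"
  assumes "enumerates s (power_multiset \<alpha> \<mu>)"
  obtains e where "\<And>j. j \<in> {1..size \<mu>} \<Longrightarrow> s j = umbra \<alpha> ^ e j"
    and "(\<Prod>j\<in>{1..size \<mu>}. E (umbra \<alpha> ^ e j)) = (\<Prod>j\<in>#\<mu>. E (umbra \<alpha> ^ j))"
proof -
  have s: "image_mset s (mset_set {1..size \<mu>}) = {#umbra \<alpha> ^ j. j \<in># \<mu>#}"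
    using assms by (simp add: enumerates_def power_multiset_def)
  have "\<exists>e. s j = umbra \<alpha> ^ e" if "j \<in> {1..size \<mu>}" for j
  proof -
    have "s j \<in># image_mset s (mset_set {1..size \<mu>})" using that by simp
    then show ?thesis unfolding s by auto
  qed
  then obtain e where e: "\<And>j. j \<in> {1..size \<mu>} \<Longrightarrow> s j = umbra \<alpha> ^ e j" by metis
  have "(\<Prod>j\<in>{1..size \<mu>}. E (umbra \<alpha> ^ e j)) = (\<Prod>j\<in>{1..size \<mu>}. E (s j))"
    by (rule prod.cong) (simp_all add: e)
  also have "\<dots> = (\<Prod>p\<in>#image_mset s (mset_set {1..size \<mu>}). E p)"
    by (simp add: prod_unfold_prod_mset image_mset.compositionality o_def)
  also have "\<dots> = (\<Prod>j\<in>#\<mu>. E (umbra \<alpha> ^ j))"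
    unfolding s by (simp add: image_mset.compositionality o_def)
  finally show ?thesis using that e by blast
qed

text \<open>The inner sum of the theorem, with the powers of the umbrae similar to \<open>\<chi>.\<chi>\<close> already replaced by
  their moments. The right-hand side depends on \<open>\<mu>\<close> only through the moments belonging to its parts,
  so any enumeration of the powers will do.\<close>

lemma (in umbral_calculus) E_subdivision_sum:
  assumes "size \<mu> \<le> n" and inj: "inj_on as {1..n}"
    and similar: "\<And>i j. i \<in> {1..n} \<Longrightarrow> E (umbra (as i) ^ j) = E (umbra \<alpha> ^ j)"
    and "enumerates s (power_multiset \<alpha> \<mu>)"
  shows "(\<Sum>\<pi> | partition_on {1..size \<mu>} \<pi>. (\<Prod>B\<in>\<pi>. partition_moebius (card B)) *
      E (dot_sum_subdivision n as \<alpha> (subdivision s \<pi>))) =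
    falling (of_nat n) (size \<mu>) * (\<Prod>j\<in>#\<mu>. E (umbra \<alpha> ^ j))"
proof -
  obtain e where e: "\<And>j. j \<in> {1..size \<mu>} \<Longrightarrow> s j = umbra \<alpha> ^ e j"
    and prod_e: "(\<Prod>j\<in>{1..size \<mu>}. E (umbra \<alpha> ^ e j)) = (\<Prod>j\<in>#\<mu>. E (umbra \<alpha> ^ j))"
    using enumeration_of_powers[OF assms(4)] by blast
  have "(\<Sum>\<pi> | partition_on {1..size \<mu>} \<pi>. (\<Prod>B\<in>\<pi>. partition_moebius (card B)) *
      E (dot_sum_subdivision n as \<alpha> (subdivision s \<pi>))) =
    (\<Sum>\<pi> | partition_on {1..size \<mu>} \<pi>. (\<Prod>B\<in>\<pi>. partition_moebius (card B)) *
      E (\<Prod>B\<in>\<pi>. \<Sum>i\<in>{1..n}. \<Prod>j\<in>B. umbra (as i) ^ e j))"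
    by (rule sum.cong[OF refl]) (simp only: mem_Collect_eq dot_sum_subdivision_powers[OF e])
  also have "\<dots> = falling (of_nat n) (card {1..size \<mu>}) * (\<Prod>j\<in>{1..size \<mu>}. E (umbra \<alpha> ^ e j))"
    using assms(1) by (intro E_moebius_power_sums inj similar) auto
  finally show ?thesis by (simp only: prod_e card_atLeastAtMost diff_Suc_1)
qed

lemma (in umbral_calculus) umbrae_in_dot_sum_subdivision:
  assumes "enumerates s (power_multiset \<alpha> \<mu>)" and \<pi>: "partition_on {1..size \<mu>} \<pi>"
  shows "umbrae_in (dot_sum_subdivision n as \<alpha> (subdivision s \<pi>) :: ('a, 'k) umbral_poly) \<subseteq>
    as ` {1..n}"
proof -
  obtain e where "\<And>j. j \<in> {1..size \<mu>} \<Longrightarrow> s j = umbra \<alpha> ^ e j"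
    using enumeration_of_powers[OF assms(1)] by blast
  then have S: "dot_sum_subdivision n as \<alpha> (subdivision s \<pi>) =
      (\<Prod>B\<in>\<pi>. \<Sum>i\<in>{1..n}. \<Prod>j\<in>B. umbra (as i) ^ e j)"
    by (rule dot_sum_subdivision_powers[OF _ \<pi>])
  have "umbrae_in (\<Prod>j\<in>B. umbra (as i) ^ e j :: ('a, 'k) umbral_poly) \<subseteq> {as i}" for B i
    using umbrae_in_prod_umbra_power[of "\<lambda>_. as i" e B] by auto
  then have "umbrae_in (\<Sum>i\<in>{1..n}. \<Prod>j\<in>B. umbra (as i) ^ e j :: ('a, 'k) umbral_poly) \<subseteq>
      as ` {1..n}" for B
    using umbrae_in_sum[of "\<lambda>i. \<Prod>j\<in>B. umbra (as i) ^ e j" "{1..n}"] by blast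
  then show ?thesis
    unfolding S
    using umbrae_in_prod[of "\<lambda>B. \<Sum>i\<in>{1..n}. \<Prod>j\<in>B. umbra (as i) ^ e j" \<pi>] by blast
qed

section \<open>Polykays in terms of power sums\<close>

theorem theorem4p2:
  fixes E :: "('a, 'k::field_char_0) umbral_poly \<Rightarrow> 'k"
    and \<alpha> \<chi> \<chi>\<chi> :: 'a
    and n :: nat
    and rs :: "nat list"
    and k :: "('a, 'k) umbral_poly"
    and as x c :: "nat \<Rightarrow> 'a"
    and d :: "nat set set \<Rightarrow> nat set \<Rightarrow> 'a"
    and s :: "nat multiset list \<Rightarrow> nat \<Rightarrow> ('a, 'k) umbral_poly"
  assumes "umbral_calculus E"
    and "n > 0"
    and "\<forall>r\<in>set rs. r > 0"
    and "sum_list rs \<le> n"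
    and "is_polykay E \<alpha> rs k"
    \<comment> \<open>the umbrae \<open>\<alpha>\<^sub>1, \<dots>, \<alpha>\<^sub>n\<close> underlying the power sums\<close>
    and "uncorrelated_on {1..n} (\<lambda>i. umbra (as i) :: ('a, 'k) umbral_poly)"
    and "\<And>i. i \<in> {1..n} \<Longrightarrow> similar E (umbra (as i)) (umbra \<alpha>)"
    \<comment> \<open>\<open>c i\<close> is the dot product of the singleton umbra \<open>x i\<close> with itself\<close>
    and "uncorrelated_on {..<length rs} (\<lambda>i. umbra (x i) :: ('a, 'k) umbral_poly)"
    and "uncorrelated_on {..<length rs} (\<lambda>i. umbra (c i) :: ('a, 'k) umbral_poly)"
    and "\<And>i. i < length rs \<Longrightarrow> is_singleton_umbra E (x i)"
    and "\<And>i. i < length rs \<Longrightarrow> is_dot_product E (x i) (x i) (c i)"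
    \<comment> \<open>for every set partition, uncorrelated umbrae \<open>d \<pi> B\<close> similar to the dot product \<open>\<chi>\<chi>\<close>\<close>
    and "is_singleton_umbra E \<chi>"
    and "is_dot_product E \<chi> \<chi> \<chi>\<chi>"
    and "\<And>m \<pi>. partition_on {1..m} \<pi> \<Longrightarrow>
           uncorrelated_on \<pi> (\<lambda>B. umbra (d \<pi> B) :: ('a, 'k) umbral_poly)"
    and "\<And>m \<pi> B. partition_on {1..m} \<pi> \<Longrightarrow> B \<in> \<pi> \<Longrightarrow>
           similar E (umbra (d \<pi> B)) (umbra \<chi>\<chi>)"
    \<comment> \<open>the different kinds of factors are uncorrelated\<close>
    and "\<And>i j. i < length rs \<Longrightarrow> j \<in> {1..n} \<Longrightarrow>
           uncorrelated (umbra (c i) :: ('a, 'k) umbral_poly) (umbra (as j))"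
    and "\<And>i m \<pi> B. i < length rs \<Longrightarrow> partition_on {1..m} \<pi> \<Longrightarrow> B \<in> \<pi> \<Longrightarrow>
           uncorrelated (umbra (c i) :: ('a, 'k) umbral_poly) (umbra (d \<pi> B))"
    and "\<And>j m \<pi> B. j \<in> {1..n} \<Longrightarrow> partition_on {1..m} \<pi> \<Longrightarrow> B \<in> \<pi> \<Longrightarrow>
           uncorrelated (umbra (as j) :: ('a, 'k) umbral_poly) (umbra (d \<pi> B))"
    and "\<And>\<Lambda>. \<Lambda> \<in> listset (map int_partitions rs) \<Longrightarrow>
           enumerates (s \<Lambda>) (power_multiset \<alpha> (sum_list \<Lambda>))"
  shows "umbral_equiv E k
    (\<Sum>\<Lambda>\<in>listset (map int_partitions rs).
       const ((\<Prod>\<mu>\<leftarrow>\<Lambda>. partition_coeff \<mu>) / falling (of_nat n) (size (sum_list \<Lambda>))) *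
       (\<Prod>i<length rs. umbra (c i) ^ size (\<Lambda> ! i)) *
       (\<Sum>\<pi> | partition_on {1..size (sum_list \<Lambda>)} \<pi>.
          partition_power (d \<pi>) \<pi> * dot_sum_subdivision n as \<alpha> (subdivision (s \<Lambda>) \<pi>)))"
proof -
  interpret umbral_calculus E by fact
  let ?a = "\<lambda>j. E (umbra \<alpha> ^ j)"
  let ?L = "listset (map int_partitions rs)"
  have rs_le: "sum_list rs \<le> n" by fact
  have inj_as: "inj_on as {1..n}" and inj_c: "inj_on c {..<length rs}"
    using assms(6,9) by (simp_all only: uncorrelated_on_umbra_iff)
  have inj_d: "inj_on (d \<pi>) \<pi>" if "partition_on {1..m} \<pi>" for m \<pi>
    using assms(14)[OF that] by (simp only: uncorrelated_on_umbra_iff)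
  have as_moment: "E (umbra (as i) ^ j) = ?a j" if "i \<in> {1..n}" for i j
    using assms(7)[OF that] by (simp add: similar_def)
  have c_moment: "E (umbra (c i) ^ m) = partition_moebius m" if "i < length rs" for i m
    using moment_singleton_dot_singleton[OF assms(10,11)[OF that]] .
  have d_moment: "E (umbra (d \<pi> B) ^ l) = partition_moebius l"
    if "partition_on {1..m} \<pi>" "B \<in> \<pi>" for m \<pi> B l
    using assms(15)[OF that] moment_singleton_dot_singleton[OF assms(12,13)]
    by (simp add: similar_def)
  have c_ne_as: "c i \<noteq> as j" if "i < length rs" "j \<in> {1..n}" for i j
    using assms(16)[OF that] by (simp add: uncorrelated_def)
  have c_ne_d: "c i \<noteq> d \<pi> B" if "i < length rs" "partition_on {1..m} \<pi>" "B \<in> \<pi>" for i m \<pi> B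
    using assms(17)[OF that] by (simp add: uncorrelated_def)
  have as_ne_d: "as j \<noteq> d \<pi> B" if "j \<in> {1..n}" "partition_on {1..m} \<pi>" "B \<in> \<pi>" for j m \<pi> B
    using assms(18)[OF that] by (simp add: uncorrelated_def)

  \<comment> \<open>The identity holds summand by summand: the family \<open>\<Lambda>\<close> of partitions contributes the term that it
      has in the expanded product of cumulants.\<close>
  have summand: "E (const ((\<Prod>\<mu>\<leftarrow>\<Lambda>. partition_coeff \<mu>) / falling (of_nat n) (size (sum_list \<Lambda>))) *
       (\<Prod>i<length rs. umbra (c i) ^ size (\<Lambda> ! i)) *
       (\<Sum>\<pi> | partition_on {1..size (sum_list \<Lambda>)} \<pi>.
          partition_power (d \<pi>) \<pi> * dot_sum_subdivision n as \<alpha> (subdivision (s \<Lambda>) \<pi>))) =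
      (\<Prod>\<mu>\<leftarrow>\<Lambda>. partition_moebius (size \<mu>) * partition_coeff \<mu> * (\<Prod>j\<in>#\<mu>. ?a j))"
    (is "E (const ?q * ?C * (\<Sum>\<pi> | _ \<pi>. ?D \<pi> * ?P \<pi>)) = _")
    if \<Lambda>: "\<Lambda> \<in> ?L" for \<Lambda>
  proof -
    let ?m = "size (sum_list \<Lambda>)"
    have m_le: "?m \<le> n" using size_sum_list_partitions_le[OF \<Lambda>] rs_le by simp
    have len: "length \<Lambda> = length rs" using length_listset[OF \<Lambda>] by simp
    have C_umbrae: "umbrae_in ?C \<subseteq> c ` {..<length rs}"
      by (rule umbrae_in_prod_umbra_power)
    have EC: "E ?C = (\<Prod>\<mu>\<leftarrow>\<Lambda>. partition_moebius (size \<mu>))"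
      using E_prod_distinct_umbrae[OF finite_lessThan inj_c, of "\<lambda>i. size (\<Lambda> ! i)"]
      by (simp add: c_moment prod_list_map_conv_nth len)
    have product: "E (?C * (?D \<pi> * ?P \<pi>)) =
        E ?C * ((\<Prod>B\<in>\<pi>. partition_moebius (card B)) * E (?P \<pi>))"
      if \<pi>: "partition_on {1..?m} \<pi>" for \<pi>
    proof -
      have "finite \<pi>" using \<pi> by (rule finite_elements[rotated]) simp
      then have ED: "E (?D \<pi>) = (\<Prod>B\<in>\<pi>. partition_moebius (card B))"
        unfolding partition_power_def
        by (subst E_prod_distinct_umbrae[OF _ inj_d[OF \<pi>]]) (simp_all add: d_moment[OF \<pi>])
      have D_umbrae: "umbrae_in (?D \<pi>) \<subseteq> d \<pi> ` \<pi>"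
        unfolding partition_power_def by (rule umbrae_in_prod_umbra_power)
      have P_umbrae: "umbrae_in (?P \<pi>) \<subseteq> as ` {1..n}"
        by (rule umbrae_in_dot_sum_subdivision[OF assms(19)[OF \<Lambda>] \<pi>])
      have "uncorrelated (?D \<pi>) (?P \<pi>)"
        using D_umbrae P_umbrae as_ne_d[OF _ \<pi>] unfolding uncorrelated_def by blast
      moreover have "uncorrelated ?C (?D \<pi> * ?P \<pi>)"
        using C_umbrae D_umbrae P_umbrae umbrae_in_mult[of "?D \<pi>" "?P \<pi>"] c_ne_as c_ne_d[OF _ \<pi>]
        unfolding uncorrelated_def by blast
      ultimately show ?thesis by (simp only: E_mult_uncorrelated ED)
    qed
    have "E (const ?q * ?C * (\<Sum>\<pi> | partition_on {1..?m} \<pi>. ?D \<pi> * ?P \<pi>)) =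
        ?q * (\<Sum>\<pi> | partition_on {1..?m} \<pi>. E (?C * (?D \<pi> * ?P \<pi>)))"
      by (simp only: mult.assoc sum_distrib_left E_const_mult E_sum)
    also have "\<dots> = ?q * (E ?C * (\<Sum>\<pi> | partition_on {1..?m} \<pi>.
        (\<Prod>B\<in>\<pi>. partition_moebius (card B)) * E (?P \<pi>)))"
      unfolding sum_distrib_left
    proof (rule sum.cong[OF refl])
      fix \<pi> assume "\<pi> \<in> {\<pi>. partition_on {1..?m} \<pi>}"
      then show "?q * E (?C * (?D \<pi> * ?P \<pi>)) =
          ?q * (E ?C * ((\<Prod>B\<in>\<pi>. partition_moebius (card B)) * E (?P \<pi>)))"
        using product[of \<pi>] by simp
    qed
    also have "\<dots> = ?q * (E ?C * (falling (of_nat n) ?m * (\<Prod>j\<in>#sum_list \<Lambda>. ?a j)))"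
      by (subst E_subdivision_sum[OF m_le inj_as as_moment assms(19)[OF \<Lambda>]]) auto
    also have "\<dots> = (\<Prod>\<mu>\<leftarrow>\<Lambda>. partition_coeff \<mu>) * E ?C * (\<Prod>j\<in>#sum_list \<Lambda>. ?a j)"
      using falling_of_nat_nonzero[OF m_le, where 'k = 'k] by simp
    also have "\<dots> = (\<Prod>\<mu>\<leftarrow>\<Lambda>. partition_moebius (size \<mu>) * partition_coeff \<mu> * (\<Prod>j\<in>#\<mu>. ?a j))"
      unfolding EC prod_mset_sum_list by (induction \<Lambda>) (simp_all add: ac_simps)
    finally show ?thesis .
  qed

  obtain \<chi>' \<alpha>' \<delta> :: "nat \<Rightarrow> 'a" where
    "uncorrelated_on {..<length rs} (\<lambda>i. umbra (\<delta> i) :: ('a, 'k) umbral_poly)"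
    and \<delta>: "\<And>i. i < length rs \<Longrightarrow> is_singleton_umbra E (\<chi>' i) \<and>
           similar E (umbra (\<alpha>' i)) (umbra \<alpha>) \<and> is_dot_product E (\<chi>' i) (\<alpha>' i) (\<delta> i)"
    and k: "E k = E (\<Prod>i<length rs. umbra (\<delta> i) ^ (rs ! i))"
    using assms(5) unfolding is_polykay_def umbral_equiv_def by blast
  then have inj_\<delta>: "inj_on \<delta> {..<length rs}"
    by (simp only: uncorrelated_on_umbra_iff)
  have "E k = (\<Prod>i<length rs. E (umbra (\<delta> i) ^ (rs ! i)))"
    unfolding k by (rule E_prod_distinct_umbrae[OF finite_lessThan inj_\<delta>])
  also have "\<dots> = (\<Prod>r\<leftarrow>rs. \<Sum>\<mu>\<in>int_partitions r.
      partition_moebius (size \<mu>) * partition_coeff \<mu> * (\<Prod>j\<in>#\<mu>. ?a j))"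
    unfolding prod_list_map_conv_nth
    by (rule prod.cong[OF refl], rule cumulant_formula) (use \<delta> in auto)
  also have "\<dots> = (\<Sum>\<Lambda>\<in>?L. \<Prod>\<mu>\<leftarrow>\<Lambda>.
      partition_moebius (size \<mu>) * partition_coeff \<mu> * (\<Prod>j\<in>#\<mu>. ?a j))"
    by (rule prod_list_sum_listset)
  finally show ?thesis
    unfolding umbral_equiv_def E_sum by (simp only: summand cong: sum.cong)
qed

end
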